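(* Let $G$ be a finitely generated group of polynomial volume growth of degree $D$. For any $\epsilon>0$, with $\rho(s)=[1+\log(1+s)]^{\epsilon}$, we have $$\widetilde{\Phi}_{G,\rho}(n)\simeq \exp\left(-n^{1/(1+\epsilon)}\right).$$ Further, for any $\epsilon>0$ and any integer $k\ge 2$, with $\rho(s)=(1+\log_{[k]}(s))^{\epsilon}$, we have $$\widetilde{\Phi}_{G,\rho}(n)\simeq \exp\left(-n/(\log_{[k-1]}n)^{\epsilon}\right).$$
   Context: Word length and growth: $G$ is equipped with a finite generating tuple $S=(s_1,\dots,s_q)$, and $S^*=\{e,s_1^{\pm1},\dots,s_q^{\pm1}\}$. For $g\in G$, $|g|$ is the least integer $m$ such that $g=\sigma_1\cdots\sigma_m$ with $\sigma_i\in S^*$ (and $|e|=0$). $G$ has polynomial volume growth of degree $D$ if $V(n)=\#\{g\in G:|g|\le n\}\simeq n^D$. Relation $\simeq$: for two monotone functions $f_1,f_2$, $f_1\simeq f_2$ means that there exist $c_1,c_2,c_3,c_4\in(0,\infty)$ such that $c_1f_1(c_2t)\le f_2(t)\le c_3f_1(c_4t)$ on the domain of definition of $f_1,f_2$ (usually a neighborhood of $0$ or of infinity; in some cases one or both functions are defined only on a countable set such as $\mathbb N$). Iterated logarithms: $\log_{[0]}x=x$ and $\log_{[k]}(x)=\log(1+\log_{[k-1]}x)$ for $k\ge1$. Weak moments: for $\rho:[0,\infty)\to[1,\infty)$ with $\rho(0)=1$ and a probability measure $\mu$ on $G$, set $W(\rho,\mu)=\sup_{s>0}\{s\,\mu(\{g:\rho(|g|)>s\})\}$.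 Let $\widetilde{\mathcal S}_{G,\rho}$ be the set of all symmetric probability measures $\phi$ on $G$ (i.e. $\phi(g)=\phi(g^{-1})$) with $W(\rho,\phi)\le2$, and $$\widetilde{\Phi}_{G,\rho}(n)=\inf\{\phi^{(2n)}(e):\phi\in\widetilde{\mathcal S}_{G,\rho}\},$$ where $\phi^{(m)}$ is the $m$-fold convolution power of $\phi$ and $e$ is the identity element.
   Formalization: The formal theorem assumes D > 0, i.e. that G is infinite; for finite G (D = 0) the return probability is at least 1/|G|, so the claimed decay is false. *)

theory Defs
  imports "HOL-Probability.Probability" "HOL-Algebra.Generated_Groups"
begin

text \<open>Everything below depends on a group \<open>G\<close> and a tuple \<open>S = (s\<^sub>1, \<dots>, s\<^sub>q)\<close> of
  elements of \<open>G\<close>, given as a list.\<close>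

definition generating_tuple :: "('a, 'b) monoid_scheme \<Rightarrow> 'a list \<Rightarrow> bool" where
  "generating_tuple G S \<longleftrightarrow> set S \<subseteq> carrier G \<and> generate G (set S) = carrier G"

definition letters :: "('a, 'b) monoid_scheme \<Rightarrow> 'a list \<Rightarrow> 'a set" where
  "letters G S = {\<one>\<^bsub>G\<^esub>} \<union> set S \<union> m_inv G ` set S"

definition word_prod :: "('a, 'b) monoid_scheme \<Rightarrow> 'a list \<Rightarrow> 'a" where
  "word_prod G w = foldr (\<lambda>x y. x \<otimes>\<^bsub>G\<^esub> y) w \<one>\<^bsub>G\<^esub>"

definition word_length :: "('a, 'b) monoid_scheme \<Rightarrow> 'a list \<Rightarrow> 'a \<Rightarrow> nat" where
  "word_length G S g =
     (LEAST m. \<exists>w. length w = m \<and> set w \<subseteq> letters G S \<and> word_prod G w = g)"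

definition volume :: "('a, 'b) monoid_scheme \<Rightarrow> 'a list \<Rightarrow> nat \<Rightarrow> real" where
  "volume G S n = real (card {g \<in> carrier G. word_length G S g \<le> n})"

text \<open>The relation \<open>\<simeq>\<close> on the neighbourhood \<open>[1, \<infinity>)\<close> of infinity. The monotonicity of
  \<open>f\<^sub>1\<close> and \<open>f\<^sub>2\<close> is not part of the relation.\<close>

definition simeq :: "(real \<Rightarrow> real) \<Rightarrow> (real \<Rightarrow> real) \<Rightarrow> bool" where
  "simeq f1 f2 \<longleftrightarrow>
     (\<exists>c1>0. \<exists>c2>0. \<exists>c3>0. \<exists>c4>0. \<forall>t\<ge>1.
        c1 * f1 (c2 * t) \<le> f2 t \<and> f2 t \<le> c3 * f1 (c4 * t))"

text \<open>A function that is only defined on the natural numbers has to be evaluated at the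
  rescaled points \<open>c * t\<close> in \<open>\<simeq>\<close>; it is extended to \<open>[0, \<infinity>)\<close> as a step function.\<close>

definition step_ext :: "(nat \<Rightarrow> real) \<Rightarrow> real \<Rightarrow> real" where
  "step_ext f t = f (nat \<lfloor>t\<rfloor>)"

definition polynomial_growth :: "('a, 'b) monoid_scheme \<Rightarrow> 'a list \<Rightarrow> real \<Rightarrow> bool" where
  "polynomial_growth G S D \<longleftrightarrow> simeq (step_ext (volume G S)) (\<lambda>t. t powr D)"

primrec iter_log :: "nat \<Rightarrow> real \<Rightarrow> real" where
  "iter_log 0 x = x"
| "iter_log (Suc k) x = ln (1 + iter_log k x)"

text \<open>A probability measure on the (countable) group \<open>G\<close> is a probability mass function
  supported in \<open>carrier G\<close>. The supremum is taken in \<open>[0, \<infinity>]\<close>.\<close>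

definition weak_moment ::
    "('a, 'b) monoid_scheme \<Rightarrow> 'a list \<Rightarrow> (real \<Rightarrow> real) \<Rightarrow> 'a pmf \<Rightarrow> ennreal" where
  "weak_moment G S \<rho> \<mu> =
     (SUP s\<in>{0<..}. ennreal (s * measure_pmf.prob \<mu>
        {g \<in> carrier G. \<rho> (real (word_length G S g)) > s}))"

definition symmetric_weak_measures ::
    "('a, 'b) monoid_scheme \<Rightarrow> 'a list \<Rightarrow> (real \<Rightarrow> real) \<Rightarrow> 'a pmf set" where
  "symmetric_weak_measures G S \<rho> =
     {\<phi>. set_pmf \<phi> \<subseteq> carrier G \<and>
          (\<forall>g\<in>carrier G. pmf \<phi> g = pmf \<phi> (inv\<^bsub>G\<^esub> g)) \<and>
          weak_moment G S \<rho> \<phi> \<le> 2}"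

definition convolution_pmf :: "('a, 'b) monoid_scheme \<Rightarrow> 'a pmf \<Rightarrow> 'a pmf \<Rightarrow> 'a pmf" where
  "convolution_pmf G \<phi> \<psi> = map_pmf (\<lambda>(x, y). x \<otimes>\<^bsub>G\<^esub> y) (pair_pmf \<phi> \<psi>)"

primrec conv_power :: "('a, 'b) monoid_scheme \<Rightarrow> 'a pmf \<Rightarrow> nat \<Rightarrow> 'a pmf" where
  "conv_power G \<phi> 0 = return_pmf \<one>\<^bsub>G\<^esub>"
| "conv_power G \<phi> (Suc m) = convolution_pmf G \<phi> (conv_power G \<phi> m)"

definition Phi_tilde ::
    "('a, 'b) monoid_scheme \<Rightarrow> 'a list \<Rightarrow> (real \<Rightarrow> real) \<Rightarrow> nat \<Rightarrow> real" where
  "Phi_tilde G S \<rho> n =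
     (INF \<phi>\<in>symmetric_weak_measures G S \<rho>. pmf (conv_power G \<phi> (2 * n)) \<one>\<^bsub>G\<^esub>)"

end

theory Submission imports Defs "HOL-Real_Asymp.Real_Asymp"
begin

text \<open>Let \<open>V\<close> be the volume. For the upper bound take, for a radius \<open>r\<close>, the measure that stays at
  \<open>e\<close> with probability \<open>1 - 1 / \<rho> r\<close> and otherwise jumps uniformly in the ball of radius \<open>r\<close>.
  It has weak moment at most 1, and since a single uniform jump already bounds all point masses by
  \<open>1 / V r\<close>, its return probability at time \<open>2n\<close> is at most \<open>exp (-2n / \<rho> r) + 1 / V r\<close>.
  For the lower bound, any admissible \<open>\<phi>\<close> gives the ball of radius \<open>r\<close> mass at least \<open>1 - 4 / \<rho> r\<close>, so
  \<open>\<phi>\<^bsup>(n)\<^esup>\<close> gives the ball of radius \<open>n r\<close> mass at least \<open>(1 - 4 / \<rho> r)\<^bsup>n\<^esup>\<close>, and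
  Cauchy--Schwarz yields \<open>\<phi>\<^bsup>(2n)\<^esup>(e) \<ge> exp (-16n / \<rho> r) / V (n r)\<close> as soon as \<open>\<rho> r \<ge> 8\<close>.
  As \<open>V r\<close> is comparable to \<open>(1 + r)\<^bsup>D\<^esup>\<close>, it remains to choose \<open>r\<close>: its logarithm is of order
  \<open>n\<^bsup>1/(1+\<epsilon>)\<^esup>\<close> in the logarithmic case, while in the iterated case a logarithm of order
  \<open>n\<close> serves the upper and one of order \<open>n\<^bsup>1/2\<^esup>\<close> the lower bound.\<close>

section \<open>Words, word length and balls\<close>

locale generated_group = group G for G (structure) +
  fixes S :: "'a list"
  assumes generating: "generating_tuple G S"
begin

abbreviation wlen :: "'a \<Rightarrow> nat" where "wlen \<equiv> word_length G S"

definition wball :: "nat \<Rightarrow> 'a set" where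
  "wball r = {g \<in> carrier G. wlen g \<le> r}"

lemma volume_eq: "volume G S r = real (card (wball r))"
  by (simp add: volume_def wball_def)

lemma S_carrier: "set S \<subseteq> carrier G"
  using generating by (simp add: generating_tuple_def)

lemma letters_carrier: "letters G S \<subseteq> carrier G"
  using S_carrier by (auto simp: letters_def)

lemma finite_letters: "finite (letters G S)"
  by (simp add: letters_def)

lemma inv_letters: "x \<in> letters G S \<Longrightarrow> inv x \<in> letters G S"
  using S_carrier by (auto simp: letters_def)

lemma word_prod_Nil [simp]: "word_prod G [] = \<one>"
  and word_prod_Cons [simp]: "word_prod G (x # w) = x \<otimes> word_prod G w"
  by (simp_all add: word_prod_def)

lemma word_prod_closed: "set w \<subseteq> carrier G \<Longrightarrow> word_prod G w \<in> carrier G"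
  by (induction w) auto

lemma word_prod_append:
  "set u \<subseteq> carrier G \<Longrightarrow> set v \<subseteq> carrier G \<Longrightarrow>
    word_prod G (u @ v) = word_prod G u \<otimes> word_prod G v"
  by (induction u) (auto simp: word_prod_closed m_assoc)

lemma word_prod_inv:
  "set w \<subseteq> carrier G \<Longrightarrow> word_prod G (rev (map (m_inv G) w)) = inv (word_prod G w)"
proof (induction w)
  case (Cons x w)
  have "set (rev (map (m_inv G) w)) \<subseteq> carrier G"
    using Cons.prems by auto
  then show ?case
    using Cons by (simp add: word_prod_append word_prod_closed inv_mult_group)
qed simp

text \<open>Needed for the \<open>LEAST\<close> in \<open>word_length\<close> to be attained at
  every element of the carrier.\<close>

lemma ex_word:
  assumes "g \<in> carrier G"
  shows "\<exists>w. set w \<subseteq> letters G S \<and> word_prod G w = g"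
proof -
  have "g \<in> generate G (set S)"
    using assms generating by (simp add: generating_tuple_def)
  then show ?thesis
  proof (induction rule: generate.induct)
    case one
    show ?case by (rule exI[of _ "[]"]) simp
  next
    case (incl h)
    then have "h \<in> carrier G" using S_carrier by auto
    with incl show ?case
      by (intro exI[of _ "[h]"]) (auto simp: letters_def)
  next
    case (inv h)
    then have "h \<in> carrier G" using S_carrier by auto
    with inv show ?case
      by (intro exI[of _ "[m_inv G h]"]) (auto simp: letters_def)
  next
    case (eng h1 h2)
    then obtain u v where "set u \<subseteq> letters G S" "word_prod G u = h1"
      "set v \<subseteq> letters G S" "word_prod G v = h2" by blast
    then show ?case
      using letters_carrier by (intro exI[of _ "u @ v"]) (auto simp: word_prod_append)
  qed
qed

lemma obtain_word:
  assumes "g \<in> carrier G"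
  obtains w where "length w = wlen g" "set w \<subseteq> letters G S" "word_prod G w = g"
proof -
  obtain w where "set w \<subseteq> letters G S" "word_prod G w = g"
    using ex_word[OF assms] by blast
  then have "\<exists>m w. length w = m \<and> set w \<subseteq> letters G S \<and> word_prod G w = g" by blast
  from LeastI_ex[OF this] show ?thesis
    using that unfolding word_length_def by blast
qed

lemma wlen_le: "set w \<subseteq> letters G S \<Longrightarrow> wlen (word_prod G w) \<le> length w"
  unfolding word_length_def by (rule Least_le) blast

lemma wlen_one [simp]: "wlen \<one> = 0"
  using wlen_le[of "[]"] by simp

lemma wlen_mult:
  assumes "g \<in> carrier G" "h \<in> carrier G"
  shows "wlen (g \<otimes> h) \<le> wlen g + wlen h"
proof -
  obtain u where u: "length u = wlen g" "set u \<subseteq> letters G S" "word_prod G u = g"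
    using assms(1) by (rule obtain_word)
  obtain v where v: "length v = wlen h" "set v \<subseteq> letters G S" "word_prod G v = h"
    using assms(2) by (rule obtain_word)
  have "word_prod G (u @ v) = g \<otimes> h"
    using u v letters_carrier by (subst word_prod_append) auto
  then show ?thesis using wlen_le[of "u @ v"] u v by simp
qed

lemma wlen_inv_le:
  assumes "g \<in> carrier G"
  shows "wlen (inv g) \<le> wlen g"
proof -
  obtain u where u: "length u = wlen g" "set u \<subseteq> letters G S" "word_prod G u = g"
    using assms by (rule obtain_word)
  have "word_prod G (rev (map (m_inv G) u)) = inv g"
    using u letters_carrier by (subst word_prod_inv) auto
  moreover have "set (rev (map (m_inv G) u)) \<subseteq> letters G S"
    using u inv_letters by auto
  ultimately show ?thesis using wlen_le[of "rev (map (m_inv G) u)"] u by simp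
qed

lemma wlen_inv: "g \<in> carrier G \<Longrightarrow> wlen (inv g) = wlen g"
  using wlen_inv_le[of g] wlen_inv_le[of "inv g"] by simp

lemma wball_carrier: "wball r \<subseteq> carrier G"
  by (auto simp: wball_def)

lemma one_in_wball: "\<one> \<in> wball r"
  by (simp add: wball_def)

lemma finite_wball: "finite (wball r)"
proof (rule finite_subset)
  show "wball r \<subseteq> word_prod G ` {w. set w \<subseteq> letters G S \<and> length w \<le> r}"
  proof
    fix g assume "g \<in> wball r"
    then have g: "g \<in> carrier G" "wlen g \<le> r" by (auto simp: wball_def)
    obtain w where "length w = wlen g" "set w \<subseteq> letters G S" "word_prod G w = g"
      using g(1) by (rule obtain_word)
    then show "g \<in> word_prod G ` {w. set w \<subseteq> letters G S \<and> length w \<le> r}"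
      using g(2) by auto
  qed
  show "finite (word_prod G ` {w. set w \<subseteq> letters G S \<and> length w \<le> r})"
    using finite_lists_length_le[OF finite_letters] by blast
qed

lemma volume_mono: "r \<le> r' \<Longrightarrow> volume G S r \<le> volume G S r'"
  unfolding volume_eq by (intro of_nat_mono card_mono finite_wball) (auto simp: wball_def)

lemma volume_ge_1: "1 \<le> volume G S r"
proof -
  have "card (wball r) > 0"
    using one_in_wball[of r] finite_wball[of r] by (auto simp: card_gt_0_iff)
  then show ?thesis by (simp add: volume_eq)
qed

section \<open>Convolution powers and their symmetry\<close>

lemma convolution_pmf_bind:
  "convolution_pmf G \<phi> \<psi> = bind_pmf \<phi> (\<lambda>x. map_pmf (\<lambda>y. x \<otimes> y) \<psi>)"
  unfolding convolution_pmf_def pair_pmf_def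
  by (simp add: map_bind_pmf map_pmf_def[symmetric] bind_return_pmf' map_pmf_comp)

text \<open>The two independent factors may be sampled in either order: here right translates of
  \<open>\<phi>\<close> are averaged, before left translates of \<open>\<psi>\<close>.\<close>

lemma convolution_pmf_bind':
  "convolution_pmf G \<phi> \<psi> = bind_pmf \<psi> (\<lambda>y. map_pmf (\<lambda>x. x \<otimes> y) \<phi>)"
  unfolding convolution_pmf_bind map_pmf_def by (rule bind_commute_pmf)

lemma set_pmf_convolution:
  "set_pmf \<phi> \<subseteq> carrier G \<Longrightarrow> set_pmf \<psi> \<subseteq> carrier G \<Longrightarrow>
    set_pmf (convolution_pmf G \<phi> \<psi>) \<subseteq> carrier G"
  by (auto simp: convolution_pmf_def)

lemma set_conv_power:
  "set_pmf \<phi> \<subseteq> carrier G \<Longrightarrow> set_pmf (conv_power G \<phi> n) \<subseteq> carrier G"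
  by (induction n) (simp_all add: set_pmf_convolution)

lemma convolution_one:
  assumes "set_pmf \<psi> \<subseteq> carrier G"
  shows "convolution_pmf G (return_pmf \<one>) \<psi> = \<psi>"
    and "convolution_pmf G \<psi> (return_pmf \<one>) = \<psi>"
proof -
  have "map_pmf (\<lambda>y. \<one> \<otimes> y) \<psi> = map_pmf id \<psi>" "map_pmf (\<lambda>y. y \<otimes> \<one>) \<psi> = map_pmf id \<psi>"
    using assms by (intro map_pmf_cong refl; auto)+
  then show "convolution_pmf G (return_pmf \<one>) \<psi> = \<psi>"
    "convolution_pmf G \<psi> (return_pmf \<one>) = \<psi>"
    unfolding convolution_pmf_bind'[of \<psi>] convolution_pmf_bind[of _ \<psi>]
    by (simp_all add: bind_return_pmf pmf.map_id)
qed

lemma convolution_assoc: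
  assumes "set_pmf \<phi> \<subseteq> carrier G" "set_pmf \<psi> \<subseteq> carrier G" "set_pmf \<theta> \<subseteq> carrier G"
  shows "convolution_pmf G (convolution_pmf G \<phi> \<psi>) \<theta> = convolution_pmf G \<phi> (convolution_pmf G \<psi> \<theta>)"
proof -
  have "map_pmf (\<lambda>z. x \<otimes> y \<otimes> z) \<theta> = map_pmf (\<lambda>z. x \<otimes> (y \<otimes> z)) \<theta>"
    if "x \<in> set_pmf \<phi>" "y \<in> set_pmf \<psi>" for x y
    using that assms by (intro map_pmf_cong refl m_assoc) auto
  then show ?thesis
    unfolding convolution_pmf_bind
    by (auto simp: bind_assoc_pmf map_bind_pmf bind_map_pmf map_pmf_comp intro!: bind_pmf_cong)
qed

lemma conv_power_add:
  assumes "set_pmf \<phi> \<subseteq> carrier G"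
  shows "conv_power G \<phi> (m + n) = convolution_pmf G (conv_power G \<phi> m) (conv_power G \<phi> n)"
  using assms
  by (induction m) (simp_all add: convolution_one convolution_assoc set_conv_power)

text \<open>Inversion is an antihomomorphism, so the factors change places.\<close>

lemma map_inv_convolution:
  assumes "set_pmf \<phi> \<subseteq> carrier G" "set_pmf \<psi> \<subseteq> carrier G"
  shows "map_pmf (m_inv G) (convolution_pmf G \<phi> \<psi>) =
    convolution_pmf G (map_pmf (m_inv G) \<psi>) (map_pmf (m_inv G) \<phi>)"
proof -
  have "map_pmf (\<lambda>y. inv (x \<otimes> y)) \<psi> = map_pmf (\<lambda>y. inv y \<otimes> inv x) \<psi>"
    if "x \<in> set_pmf \<phi>" for x
    using that assms by (intro map_pmf_cong refl inv_mult_group) auto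
  then show ?thesis
    unfolding convolution_pmf_bind'[of "map_pmf (m_inv G) \<psi>"] convolution_pmf_bind[of \<phi> \<psi>]
    by (auto simp: map_bind_pmf bind_map_pmf map_pmf_comp intro!: bind_pmf_cong)
qed

text \<open>Inversion moves the first factor of a power to the end. Splitting the power as
  \<open>n + 1\<close> instead of \<open>1 + n\<close> shows that this changes nothing.\<close>

lemma map_inv_conv_power:
  assumes "set_pmf \<phi> \<subseteq> carrier G" "map_pmf (m_inv G) \<phi> = \<phi>"
  shows "map_pmf (m_inv G) (conv_power G \<phi> n) = conv_power G \<phi> n"
proof (induction n)
  case (Suc n)
  have 1: "conv_power G \<phi> 1 = \<phi>"
    using assms(1) by (simp add: convolution_one)
  have "map_pmf (m_inv G) (conv_power G \<phi> (Suc n)) = convolution_pmf G (conv_power G \<phi> n) \<phi>"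
    using Suc assms by (simp add: map_inv_convolution set_conv_power)
  also have "\<dots> = conv_power G \<phi> (n + 1)"
    using conv_power_add[OF assms(1), of n 1] 1 by simp
  finally show ?case by simp
qed simp

lemma pmf_map_mult:
  assumes "set_pmf \<psi> \<subseteq> carrier G" "x \<in> carrier G" "g \<in> carrier G"
  shows "pmf (map_pmf (\<lambda>y. x \<otimes> y) \<psi>) g = pmf \<psi> (inv x \<otimes> g)"
    and "pmf (map_pmf (\<lambda>y. y \<otimes> x) \<psi>) g = pmf \<psi> (g \<otimes> inv x)"
proof -
  have "x \<otimes> y = g \<longleftrightarrow> y = inv x \<otimes> g" "y \<otimes> x = g \<longleftrightarrow> y = g \<otimes> inv x"
    if "y \<in> set_pmf \<psi>" for y
    using that assms by (auto simp: inv_solve_left inv_solve_right m_assoc simp flip: m_assoc[of x])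
  \<comment> \<open>The equations can be solved for \<open>y\<close> only inside the carrier, so the
    preimages are compared within the support.\<close>
  then have "(\<lambda>y. x \<otimes> y) -` {g} \<inter> set_pmf \<psi> = {inv x \<otimes> g} \<inter> set_pmf \<psi>"
    "(\<lambda>y. y \<otimes> x) -` {g} \<inter> set_pmf \<psi> = {g \<otimes> inv x} \<inter> set_pmf \<psi>"
    by auto
  then have "measure_pmf.prob \<psi> ((\<lambda>y. x \<otimes> y) -` {g}) = measure_pmf.prob \<psi> {inv x \<otimes> g}"
    "measure_pmf.prob \<psi> ((\<lambda>y. y \<otimes> x) -` {g}) = measure_pmf.prob \<psi> {g \<otimes> inv x}"
    by (metis measure_Int_set_pmf)+
  then show "pmf (map_pmf (\<lambda>y. x \<otimes> y) \<psi>) g = pmf \<psi> (inv x \<otimes> g)"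
    "pmf (map_pmf (\<lambda>y. y \<otimes> x) \<psi>) g = pmf \<psi> (g \<otimes> inv x)"
    unfolding pmf_map by (simp_all add: pmf.rep_eq)
qed

text \<open>Turns the pointwise symmetry in \<open>symmetric_weak_measures\<close> into an equation
  between measures, which passes through convolutions.\<close>

lemma map_inv_eq_iff:
  assumes "set_pmf \<phi> \<subseteq> carrier G"
  shows "map_pmf (m_inv G) \<phi> = \<phi> \<longleftrightarrow> (\<forall>g\<in>carrier G. pmf \<phi> g = pmf \<phi> (inv g))"
proof -
  have *: "pmf (map_pmf (m_inv G) \<phi>) g = pmf \<phi> (inv g)" if "g \<in> carrier G" for g
  proof -
    have "inv y = g \<longleftrightarrow> y = inv g" if "y \<in> set_pmf \<phi>" for y
      using that assms \<open>g \<in> carrier G\<close> by auto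
    then have "m_inv G -` {g} \<inter> set_pmf \<phi> = {inv g} \<inter> set_pmf \<phi>" by auto
    then have "measure_pmf.prob \<phi> (m_inv G -` {g}) = measure_pmf.prob \<phi> {inv g}"
      by (metis measure_Int_set_pmf)
    then show ?thesis unfolding pmf_map by (simp add: pmf.rep_eq)
  qed
  \<comment> \<open>Both laws live on the carrier, so masses need comparing only there.\<close>
  have out: "pmf (map_pmf (m_inv G) \<phi>) g = 0" "pmf \<phi> g = 0" if "g \<notin> carrier G" for g
    using that assms by (auto simp: pmf_eq_0_set_pmf)
  show ?thesis
  proof
    assume "map_pmf (m_inv G) \<phi> = \<phi>"
    then show "\<forall>g\<in>carrier G. pmf \<phi> g = pmf \<phi> (inv g)"
      by (simp flip: *)
  next
    assume "\<forall>g\<in>carrier G. pmf \<phi> g = pmf \<phi> (inv g)"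
    then have "pmf (map_pmf (m_inv G) \<phi>) g = pmf \<phi> g" for g
      using *[of g] out[of g] by (metis (no_types))
    then show "map_pmf (m_inv G) \<phi> = \<phi>" by (rule pmf_eqI)
  qed
qed

section \<open>Return probability from concentration on balls\<close>

lemma prob_convolution_wball:
  assumes "set_pmf \<phi> \<subseteq> carrier G" "set_pmf \<psi> \<subseteq> carrier G"
  shows "measure_pmf.prob \<phi> (wball a) * measure_pmf.prob \<psi> (wball b)
    \<le> measure_pmf.prob (convolution_pmf G \<phi> \<psi>) (wball (a + b))"
proof -
  have "wball a \<times> wball b \<subseteq> (\<lambda>(x, y). x \<otimes> y) -` wball (a + b)"
    using wlen_mult by (fastforce simp: wball_def)
  then show ?thesis
    unfolding convolution_pmf_def measure_map_pmf
    by (subst measure_pmf_prob_product[symmetric])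
       (auto intro!: measure_pmf.finite_measure_mono simp: finite_wball countable_finite)
qed

lemma prob_conv_power_wball:
  assumes "set_pmf \<phi> \<subseteq> carrier G"
  shows "measure_pmf.prob \<phi> (wball r) ^ n \<le> measure_pmf.prob (conv_power G \<phi> n) (wball (n * r))"
proof (induction n)
  case 0
  then show ?case using one_in_wball by simp
next
  case (Suc n)
  have "measure_pmf.prob \<phi> (wball r) ^ Suc n
      \<le> measure_pmf.prob \<phi> (wball r) * measure_pmf.prob (conv_power G \<phi> n) (wball (n * r))"
    using Suc by (simp add: mult_left_mono)
  also have "\<dots> \<le> measure_pmf.prob (conv_power G \<phi> (Suc n)) (wball (r + n * r))"
    using prob_convolution_wball[OF assms set_conv_power[OF assms]] by simp
  finally show ?case by simp
qed

text \<open>By symmetry the return probability is the squared \<open>\<ell>\<^sup>2\<close> norm of \<open>\<phi>\<^bsup>(n)\<^esup>\<close>; then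
  Cauchy--Schwarz on \<open>A\<close>.\<close>

lemma conv_power_return_ge:
  assumes \<phi>: "set_pmf \<phi> \<subseteq> carrier G" "map_pmf (m_inv G) \<phi> = \<phi>" and A: "finite A"
  shows "(measure_pmf.prob (conv_power G \<phi> n) A)\<^sup>2 \<le> card A * pmf (conv_power G \<phi> (2 * n)) \<one>"
proof -
  define \<psi> where "\<psi> = conv_power G \<phi> n"
  have \<psi>: "set_pmf \<psi> \<subseteq> carrier G" "map_pmf (m_inv G) \<psi> = \<psi>"
    unfolding \<psi>_def using \<phi> by (auto intro: map_inv_conv_power set_conv_power[THEN subsetD])
  have sym: "pmf \<psi> (inv x) = pmf \<psi> x" if "x \<in> carrier G" for x
    using map_inv_eq_iff[OF \<psi>(1)] \<psi>(2) that by metis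
  \<comment> \<open>Truncation to the finite set \<open>A\<close> makes the expectation a finite
    sum; dropping it afterwards only enlarges the integrand.\<close>
  have "(\<Sum>x\<in>A. (pmf \<psi> x)\<^sup>2) = (\<Sum>x\<in>A. (if x \<in> A then pmf \<psi> x else 0) * pmf \<psi> x)"
    by (intro sum.cong) (auto simp: power2_eq_square)
  also have "\<dots> = measure_pmf.expectation \<psi> (\<lambda>x. if x \<in> A then pmf \<psi> x else 0)"
    using A by (intro integral_measure_pmf_real[symmetric]) (auto split: if_splits)
  also have "\<dots> \<le> measure_pmf.expectation \<psi> (\<lambda>x. pmf \<psi> x)"
    by (intro integral_mono measure_pmf.integrable_const_bound[of _ 1]) (auto simp: pmf_le_1)
  \<comment> \<open>By symmetry \<open>pmf \<psi> x\<close> is \<open>pmf \<psi> (inv x)\<close>,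
    the mass at \<open>\<one>\<close> of the left translate by \<open>x\<close>. Averaging over
    \<open>x\<close> gives the convolution square.\<close>
  also have "\<dots> = measure_pmf.expectation \<psi> (\<lambda>x. pmf (map_pmf (\<lambda>y. x \<otimes> y) \<psi>) \<one>)"
    using \<psi>(1) by (intro integral_cong_AE) (auto simp: AE_measure_pmf_iff pmf_map_mult sym subset_iff)
  also have "\<dots> = pmf (convolution_pmf G \<psi> \<psi>) \<one>"
    by (simp add: convolution_pmf_bind pmf_bind)
  also have "\<dots> = pmf (conv_power G \<phi> (2 * n)) \<one>"
    using conv_power_add[OF \<phi>(1), of n n] by (simp add: \<psi>_def mult_2)
  finally have "(\<Sum>x\<in>A. (pmf \<psi> x)\<^sup>2) \<le> pmf (conv_power G \<phi> (2 * n)) \<one>" .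
  moreover have "(\<Sum>x\<in>A. pmf \<psi> x)\<^sup>2 \<le> card A * (\<Sum>x\<in>A. (pmf \<psi> x)\<^sup>2)"
    using sum_squared_le_sum_of_squares[of "pmf \<psi>" A] A by (simp add: mult.commute)
  ultimately show ?thesis
    using A by (simp add: measure_measure_pmf_finite flip: \<psi>_def)
      (meson mult_left_mono of_nat_0_le_iff order_trans)
qed

section \<open>The lazy uniform walk on a ball\<close>

definition lazy_ball_walk :: "real \<Rightarrow> nat \<Rightarrow> 'a pmf" where
  "lazy_ball_walk p r =
     bind_pmf (bernoulli_pmf p) (\<lambda>b. if b then pmf_of_set (wball r) else return_pmf \<one>)"

lemma wball_ne: "wball r \<noteq> {}"
  using one_in_wball by auto

lemma set_lazy_ball_walk: "set_pmf (lazy_ball_walk p r) \<subseteq> wball r"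
  using one_in_wball
  by (auto simp: lazy_ball_walk_def finite_wball wball_ne split: if_splits)

lemma pmf_lazy_ball_walk:
  assumes "p \<in> {0..1}"
  shows "pmf (lazy_ball_walk p r) g =
    p * pmf (pmf_of_set (wball r)) g + (1 - p) * pmf (return_pmf \<one>) g"
  using assms by (simp add: lazy_ball_walk_def pmf_bind)

lemma prob_lazy_ball_walk:
  assumes "p \<in> {0..1}"
  shows "measure_pmf.prob (lazy_ball_walk p r) A =
    p * measure_pmf.prob (pmf_of_set (wball r)) A + (1 - p) * indicator A \<one>"
proof -
  \<comment> \<open>An event becomes a point mass of a Boolean law, so that \<open>pmf_bind\<close>
    can evaluate the Bernoulli mixture.\<close>
  have *: "measure_pmf.prob \<phi> A = pmf (map_pmf (\<lambda>x. x \<in> A) \<phi>) True" for \<phi> :: "'a pmf"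
    by (simp add: pmf_map vimage_def)
  show ?thesis
    unfolding * using assms
    by (simp add: lazy_ball_walk_def map_bind_pmf pmf_bind indicator_def)
qed

lemma symmetric_lazy_ball_walk:
  assumes "p \<in> {0..1}" "g \<in> carrier G"
  shows "pmf (lazy_ball_walk p r) g = pmf (lazy_ball_walk p r) (inv g)"
proof -
  have "inv g \<in> wball r \<longleftrightarrow> g \<in> wball r" "inv g = \<one> \<longleftrightarrow> g = \<one>"
    using assms inv_eq_1_iff[of g] by (auto simp: wball_def wlen_inv)
  then show ?thesis
    using assms by (simp add: pmf_lazy_ball_walk finite_wball wball_ne indicator_def eq_commute[of \<one>])
qed

text \<open>The convolution averages right translates of the uniform law, and no translate has a
  point mass above \<open>1 / volume G S r\<close>, whatever \<open>\<psi>\<close> is.\<close>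

lemma pmf_convolution_uniform_le:
  assumes "set_pmf \<psi> \<subseteq> carrier G" "g \<in> carrier G"
  shows "pmf (convolution_pmf G (pmf_of_set (wball r)) \<psi>) g \<le> 1 / volume G S r"
proof -
  have "pmf (convolution_pmf G (pmf_of_set (wball r)) \<psi>) g =
      measure_pmf.expectation \<psi> (\<lambda>y. pmf (map_pmf (\<lambda>x. x \<otimes> y) (pmf_of_set (wball r))) g)"
    by (simp add: convolution_pmf_bind' pmf_bind)
  also have "\<dots> \<le> measure_pmf.expectation \<psi> (\<lambda>y. 1 / volume G S r)"
  proof (rule integral_mono_AE)
    show "AE y in measure_pmf \<psi>. pmf (map_pmf (\<lambda>x. x \<otimes> y) (pmf_of_set (wball r))) g \<le> 1 / volume G S r"
    proof (unfold AE_measure_pmf_iff, intro ballI)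
      fix y assume "y \<in> set_pmf \<psi>"
      then have "pmf (map_pmf (\<lambda>x. x \<otimes> y) (pmf_of_set (wball r))) g = pmf (pmf_of_set (wball r)) (g \<otimes> inv y)"
        using assms wball_carrier by (intro pmf_map_mult) (auto simp: finite_wball wball_ne)
      also have "\<dots> \<le> 1 / volume G S r"
        by (simp add: finite_wball wball_ne volume_eq indicator_def)
      finally show "pmf (map_pmf (\<lambda>x. x \<otimes> y) (pmf_of_set (wball r))) g \<le> 1 / volume G S r" .
    qed
  qed (auto intro!: measure_pmf.integrable_const_bound[of _ 1] simp: pmf_le_1)
  finally show ?thesis by simp
qed

text \<open>Condition on the first step. A jump bounds the point mass by the reciprocal volume
  \<open>1 / V\<close>; otherwise the induction hypothesis applies. The recursion closes because
  \<open>p / V + (1 - p) / V = 1 / V\<close>, and \<open>(1 - p) ^ m\<close> is the probability of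
  no jump at all.\<close>

lemma conv_power_lazy_ball_walk_le:
  assumes p: "p \<in> {0..1}"
  shows "g \<in> carrier G \<Longrightarrow>
    pmf (conv_power G (lazy_ball_walk p r) m) g \<le> (1 - p) ^ m + 1 / volume G S r"
proof (induction m arbitrary: g)
  case 0
  then show ?case using volume_ge_1[of r] by (simp add: indicator_def)
next
  case (Suc m)
  define \<psi> where "\<psi> = conv_power G (lazy_ball_walk p r) m"
  have \<psi>: "set_pmf \<psi> \<subseteq> carrier G"
    unfolding \<psi>_def using set_lazy_ball_walk wball_carrier by (intro set_conv_power) blast
  have conv: "convolution_pmf G (lazy_ball_walk p r) \<psi> =
      bind_pmf (bernoulli_pmf p) (\<lambda>b. convolution_pmf G (if b then pmf_of_set (wball r) else return_pmf \<one>) \<psi>)"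
    unfolding lazy_ball_walk_def convolution_pmf_bind by (simp add: bind_assoc_pmf)
  have "pmf (conv_power G (lazy_ball_walk p r) (Suc m)) g =
      p * pmf (convolution_pmf G (pmf_of_set (wball r)) \<psi>) g + (1 - p) * pmf \<psi> g"
    unfolding conv_power.simps \<psi>_def[symmetric] conv
    using p \<psi> by (simp add: pmf_bind convolution_one)
  also have "\<dots> \<le> p * (1 / volume G S r) + (1 - p) * ((1 - p) ^ m + 1 / volume G S r)"
    using p Suc \<psi> by (intro add_mono mult_left_mono pmf_convolution_uniform_le) (auto simp: \<psi>_def)
  also have "\<dots> = (1 - p) ^ Suc m + 1 / volume G S r"
    using volume_ge_1[of r] by (simp add: field_simps)
  finally show ?case .
qed

end

section \<open>Return probability bounds for a general weight\<close>

locale weight_function =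
  fixes \<rho> :: "real \<Rightarrow> real"
  assumes mono: "mono_on {0..} \<rho>" and at_0: "\<rho> 0 = 1"
begin

lemma mono_le: "0 \<le> x \<Longrightarrow> x \<le> y \<Longrightarrow> \<rho> x \<le> \<rho> y"
  using mono by (auto simp: mono_on_def)

lemma ge_1: "0 \<le> x \<Longrightarrow> 1 \<le> \<rho> x"
  using mono_le[of 0 x] at_0 by simp

end

locale weighted_group = generated_group G S + weight_function \<rho>
  for G (structure) and S \<rho>
begin

lemma weak_moment_le_iff:
  "weak_moment G S \<rho> \<phi> \<le> 2 \<longleftrightarrow>
    (\<forall>s>0. s * measure_pmf.prob \<phi> {g \<in> carrier G. \<rho> (wlen g) > s} \<le> 2)"
proof -
  have "ennreal x \<le> 2 \<longleftrightarrow> x \<le> 2" for x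
    by (metis ennreal_le_iff ennreal_numeral zero_le_numeral)
  then show ?thesis by (auto simp: weak_moment_def SUP_le_iff)
qed

text \<open>Three ranges of the level \<open>s\<close>. Below 1 a probability is at most 1; from
  \<open>\<rho> r\<close> on the event misses the ball; in between only a jump can hit it, with
  probability at most \<open>1 / \<rho> r\<close>.\<close>

lemma lazy_ball_walk_in_class:
  "lazy_ball_walk (1 / \<rho> r) r \<in> symmetric_weak_measures G S \<rho>"
proof -
  define p where "p = 1 / \<rho> r"
  have \<rho>: "1 \<le> \<rho> r" by (simp add: ge_1)
  then have p: "p \<in> {0..1}" by (auto simp: p_def)
  have "s * measure_pmf.prob (lazy_ball_walk p r) {g \<in> carrier G. \<rho> (wlen g) > s} \<le> 2"
    if "s > 0" for s
  proof -
    let ?E = "{g \<in> carrier G. \<rho> (wlen g) > s}"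
    consider "s < 1" | "s \<ge> \<rho> r" | "1 \<le> s" "s < \<rho> r" by linarith
    then show ?thesis
    proof cases
      case 1
      then have "s * measure_pmf.prob (lazy_ball_walk p r) ?E \<le> 1 * 1"
        using that by (intro mult_mono) auto
      then show ?thesis by simp
    next
      case 2
      have "?E \<inter> set_pmf (lazy_ball_walk p r) = {}"
      proof -
        have "\<rho> (wlen g) \<le> s" if "g \<in> wball r" for g
          using that mono_le[of "wlen g" r] 2 by (auto simp: wball_def)
        then show ?thesis using set_lazy_ball_walk by fastforce
      qed
      then have "measure_pmf.prob (lazy_ball_walk p r) ?E = 0"
        by (subst measure_Int_set_pmf[symmetric]) simp
      then show ?thesis by simp
    next
      case 3
      \<comment> \<open>\<open>\<one>\<close> has weight 1, which does not exceed \<open>s\<close>,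
        so staying put contributes nothing.\<close>
      then have "\<one> \<notin> ?E" using at_0 by simp
      then have "measure_pmf.prob (lazy_ball_walk p r) ?E
          = p * measure_pmf.prob (pmf_of_set (wball r)) ?E"
        using p by (simp add: prob_lazy_ball_walk)
      also have "\<dots> \<le> p * 1"
        using p by (intro mult_left_mono) auto
      finally have "s * measure_pmf.prob (lazy_ball_walk p r) ?E \<le> \<rho> r * p"
        using 3 p \<rho> by (intro mult_mono) auto
      also have "\<dots> = 1" using \<rho> by (simp add: p_def)
      finally show ?thesis by simp
    qed
  qed
  then show ?thesis
    using symmetric_lazy_ball_walk[OF p] set_lazy_ball_walk wball_carrier
    unfolding symmetric_weak_measures_def weak_moment_le_iff p_def by blast
qed

text \<open>The infimum is tested on the lazy walk with jump probability
  \<open>p = 1 / \<rho> r\<close>, and \<open>1 - p \<le> exp (- p)\<close>.\<close>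

lemma Phi_tilde_le:
  "Phi_tilde G S \<rho> n \<le> exp (- (2 * real n / \<rho> r)) + 1 / volume G S r"
proof -
  have \<rho>: "1 \<le> \<rho> r" by (simp add: ge_1)
  have "Phi_tilde G S \<rho> n \<le> pmf (conv_power G (lazy_ball_walk (1 / \<rho> r) r) (2 * n)) \<one>"
    unfolding Phi_tilde_def
    by (intro cINF_lower bdd_belowI2[of _ 0] lazy_ball_walk_in_class) auto
  also have "\<dots> \<le> (1 - 1 / \<rho> r) ^ (2 * n) + 1 / volume G S r"
    using \<rho> by (intro conv_power_lazy_ball_walk_le) auto
  also have "(1 - 1 / \<rho> r) ^ (2 * n) \<le> exp (- (1 / \<rho> r)) ^ (2 * n)"
    using exp_ge_add_one_self[of "- (1 / \<rho> r)"] \<rho> by (intro power_mono) auto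
  also have "exp (- (1 / \<rho> r)) ^ (2 * n) = exp (- (2 * real n / \<rho> r))"
    by (simp flip: exp_of_nat_mult)
  finally show ?thesis by simp
qed

text \<open>For every admissible \<open>\<phi>\<close>, the weak moment limits the mass outside the
  ball of radius \<open>r\<close>; after \<open>n\<close> steps Cauchy--Schwarz is applied on the
  ball of radius \<open>n * r\<close>.\<close>

lemma Phi_tilde_ge:
  assumes r: "8 \<le> \<rho> r"
  shows "exp (- (16 * real n / \<rho> r)) / volume G S (n * r) \<le> Phi_tilde G S \<rho> n"
  unfolding Phi_tilde_def
proof (rule cINF_greatest)
  show "symmetric_weak_measures G S \<rho> \<noteq> {}"
    using lazy_ball_walk_in_class by blast
next
  fix \<phi> assume "\<phi> \<in> symmetric_weak_measures G S \<rho>"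
  then have carr: "set_pmf \<phi> \<subseteq> carrier G"
    and sym: "\<forall>g\<in>carrier G. pmf \<phi> g = pmf \<phi> (inv g)"
    and W: "\<And>s. s > 0 \<Longrightarrow> s * measure_pmf.prob \<phi> {g \<in> carrier G. \<rho> (wlen g) > s} \<le> 2"
    unfolding symmetric_weak_measures_def weak_moment_le_iff by blast+
  note \<phi> = carr map_inv_eq_iff[OF carr, THEN iffD2, OF sym]
  \<comment> \<open>The weak moment at level \<open>\<rho> r / 2\<close> allows this mass outside
    the ball. Half of \<open>\<rho> r\<close> is taken since the event there is strict, while
    outside the ball only \<open>\<ge> \<rho> r\<close> is known. The assumption on \<open>r\<close>
    makes \<open>x \<le> 1 / 2\<close>.\<close>
  define x where "x = 4 / \<rho> r"
  have x: "0 < x" "x \<le> 1 / 2" using r by (auto simp: x_def field_simps)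
  have "carrier G - wball r \<subseteq> {g \<in> carrier G. \<rho> (wlen g) > \<rho> r / 2}"
  proof
    fix g assume "g \<in> carrier G - wball r"
    then show "g \<in> {g \<in> carrier G. \<rho> (wlen g) > \<rho> r / 2}"
      using mono_le[of r "wlen g"] r by (auto simp: wball_def)
  qed
  then have "measure_pmf.prob \<phi> (carrier G - wball r)
      \<le> measure_pmf.prob \<phi> {g \<in> carrier G. \<rho> (wlen g) > \<rho> r / 2}"
    by (intro measure_pmf.finite_measure_mono) auto
  also have "\<dots> \<le> x"
    using W[of "\<rho> r / 2"] r by (auto simp: x_def field_simps)
  finally have "measure_pmf.prob \<phi> (carrier G - wball r) \<le> x" .
  moreover have "measure_pmf.prob \<phi> (carrier G) = 1"
    using \<phi>(1) by (simp add: measure_pmf.prob_eq_1 AE_measure_pmf_iff subset_iff)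
  moreover have "measure_pmf.prob \<phi> (carrier G - wball r)
      = measure_pmf.prob \<phi> (carrier G) - measure_pmf.prob \<phi> (wball r)"
    using wball_carrier by (intro measure_pmf.finite_measure_Diff) auto
  ultimately have p: "1 - x \<le> measure_pmf.prob \<phi> (wball r)" by simp
  \<comment> \<open>From \<open>ln (1 - x) \<ge> - x - 2 * x\<^sup>2\<close> and
    \<open>2 * x \<le> 1\<close>.\<close>
  have "exp (- (2 * x)) \<le> 1 - x"
  proof -
    have "x * (2 * x) \<le> x * 1"
      using x by (intro mult_left_mono) auto
    then have "- (2 * x) \<le> ln (1 - x)"
      using ln_one_minus_pos_lower_bound[of x] x unfolding power2_eq_square by linarith
    then have "exp (- (2 * x)) \<le> exp (ln (1 - x))" by simp
    then show ?thesis using x by simp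
  qed
  \<comment> \<open>The exponent is \<open>2 * n\<close> because Cauchy--Schwarz squares the mass of
    the ball; this produces the constant 16.\<close>
  then have "exp (- (2 * x)) ^ (2 * n) \<le> (measure_pmf.prob \<phi> (wball r)) ^ (2 * n)"
    using p by (intro power_mono) auto
  also have "\<dots> = ((measure_pmf.prob \<phi> (wball r)) ^ n)\<^sup>2"
    by (simp add: power_mult[symmetric] mult.commute)
  also have "\<dots> \<le> (measure_pmf.prob (conv_power G \<phi> n) (wball (n * r)))\<^sup>2"
    by (intro power_mono prob_conv_power_wball \<phi>) auto
  also have "\<dots> \<le> volume G S (n * r) * pmf (conv_power G \<phi> (2 * n)) \<one>"
    unfolding volume_eq by (intro conv_power_return_ge \<phi> finite_wball)
  also have "exp (- (2 * x)) ^ (2 * n) = exp (- (16 * real n / \<rho> r))"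
    by (simp add: x_def flip: exp_of_nat_mult)
  finally show "exp (- (16 * real n / \<rho> r)) / volume G S (n * r) \<le> pmf (conv_power G \<phi> (2 * n)) \<one>"
    using volume_ge_1[of "n * r"] by (simp add: field_simps)
qed

end

section \<open>Volume bounds from polynomial growth\<close>

context generated_group
begin

text \<open>Removes the rescaling inside the arguments of \<open>simeq\<close>: powers turn it into
  constant factors, monotonicity of the volume absorbs the floor, and \<open>1 + r\<close> covers
  radius 0.\<close>

lemma polynomial_growth_bounds:
  assumes "polynomial_growth G S D" "D > 0"
  obtains a b where "a > 0" "b > 0"
    "\<And>r. a * (1 + real r) powr D \<le> volume G S r"
    "\<And>r. volume G S r \<le> b * (1 + real r) powr D"
proof -
  obtain c1 c2 c3 c4 where c: "c1 > 0" "c2 > 0" "c3 > 0" "c4 > 0"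
    and le: "\<And>t. t \<ge> 1 \<Longrightarrow> c1 * volume G S (nat \<lfloor>c2 * t\<rfloor>) \<le> t powr D"
    and ge: "\<And>t. t \<ge> 1 \<Longrightarrow> t powr D \<le> c3 * volume G S (nat \<lfloor>c4 * t\<rfloor>)"
    using assms(1) unfolding polynomial_growth_def simeq_def step_ext_def by blast
  define d where "d = max c4 1"
  define e where "e = min c2 1"
  have de: "d \<ge> 1" "d \<ge> c4" "e > 0" "e \<le> 1" "e \<le> c2"
    using c by (auto simp: d_def e_def)
  \<comment> \<open>The first entry serves \<open>r < d\<close>, where the volume is at least 1; the
    second serves \<open>r \<ge> d\<close>, where growth is used at
    \<open>t = r / d \<ge> 1\<close>.\<close>
  define a where "a = min (1 / (1 + d) powr D) (1 / ((2 * d) powr D * c3))"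
  define b where "b = 1 / (c1 * e powr D)"
  show ?thesis
  proof
    show "a > 0" "b > 0" using c de by (auto simp: a_def b_def)
  next
    fix r :: nat
    show "a * (1 + real r) powr D \<le> volume G S r"
    proof (cases "real r < d")
      case True
      have "a * (1 + real r) powr D \<le> 1 / (1 + d) powr D * (1 + d) powr D"
        using True de assms(2) by (intro mult_mono powr_mono2) (auto simp: a_def)
      also have "\<dots> = 1" using de by simp
      finally show ?thesis using volume_ge_1[of r] by linarith
    next
      case False
      have t: "real r / d \<ge> 1" using False de by simp
      have "c4 * (real r / d) \<le> d * (real r / d)"
        using de t by (intro mult_right_mono) auto
      then have "c4 * (real r / d) \<le> real r" using de by simp
      then have "nat \<lfloor>c4 * (real r / d)\<rfloor> \<le> r" by linarith
      then have "c3 * volume G S (nat \<lfloor>c4 * (real r / d)\<rfloor>) \<le> c3 * volume G S r"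
        using c by (intro mult_left_mono volume_mono) auto
      with ge[OF t] have "(real r / d) powr D \<le> c3 * volume G S r" by linarith
      moreover have "(1 + real r) powr D \<le> (2 * d * (real r / d)) powr D"
        using False de assms(2) by (intro powr_mono2) auto
      then have "(1 + real r) powr D \<le> (2 * d) powr D * (real r / d) powr D"
        using de by (subst powr_mult[symmetric]) auto
      ultimately have "(1 + real r) powr D \<le> (2 * d) powr D * (c3 * volume G S r)"
        by (meson mult_left_mono order_trans powr_ge_zero)
      then have "1 / ((2 * d) powr D * c3) * (1 + real r) powr D \<le> volume G S r"
        using c de by (simp add: field_simps)
      moreover have "a * (1 + real r) powr D \<le> 1 / ((2 * d) powr D * c3) * (1 + real r) powr D"
        by (intro mult_right_mono) (auto simp: a_def)
      ultimately show ?thesis by linarith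
    qed
    \<comment> \<open>Then \<open>c2 * t \<ge> 1 + r\<close>, so rounding down still leaves at least
      \<open>r\<close>; \<open>e \<le> 1\<close> ensures \<open>t \<ge> 1\<close>.\<close>
    define t where "t = (1 + real r) / e"
    have t: "t \<ge> 1" using de by (simp add: t_def field_simps)
    have "e * t \<le> c2 * t" using de t by (intro mult_right_mono) auto
    then have "1 + real r \<le> c2 * t" using de by (simp add: t_def)
    then have "r \<le> nat \<lfloor>c2 * t\<rfloor>" by linarith
    then have "c1 * volume G S r \<le> c1 * volume G S (nat \<lfloor>c2 * t\<rfloor>)"
      using c by (intro mult_left_mono volume_mono) auto
    also have "\<dots> \<le> t powr D" using le[OF t] .
    also have "\<dots> = (1 + real r) powr D / e powr D"
      using de by (simp add: t_def powr_divide)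
    finally show "volume G S r \<le> b * (1 + real r) powr D"
      using c de by (simp add: b_def field_simps)
  qed
qed

end

section \<open>Reduction to the choice of a radius\<close>

context weighted_group
begin

text \<open>The radius \<open>exp M\<close> is rounded down: this does not increase the weight, and
  \<open>1 + r \<ge> exp M\<close> keeps the volume large.\<close>

lemma Phi_tilde_le_exp:
  assumes a: "a > 0" "\<And>r. a * (1 + real r) powr D \<le> volume G S r" and D: "D > 0"
  shows "Phi_tilde G S \<rho> n \<le> exp (- (2 * real n / \<rho> (exp M))) + exp (- (D * M)) / a"
proof -
  define r where "r = nat \<lfloor>exp M\<rfloor>"
  have r: "real r \<le> exp M" "exp M \<le> 1 + real r"
    using exp_gt_zero[of M] unfolding r_def by linarith+
  have "exp (D * M) = exp M powr D"
    by (simp add: powr_def)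
  also have "\<dots> \<le> (1 + real r) powr D"
    using r D by (intro powr_mono2) auto
  finally have "a * exp (D * M) \<le> a * (1 + real r) powr D" using a(1) by simp
  also have "\<dots> \<le> volume G S r" by (rule a(2))
  finally have "1 / volume G S r \<le> 1 / (a * exp (D * M))"
    using a(1) by (intro divide_left_mono mult_pos_pos) (auto intro: less_le_trans[OF _ volume_ge_1])
  also have "\<dots> = exp (- (D * M)) / a" by (simp add: exp_minus field_simps)
  finally have 1: "1 / volume G S r \<le> exp (- (D * M)) / a" .
  have "2 * real n / \<rho> (exp M) \<le> 2 * real n / \<rho> r"
    using mono_le[of r "exp M"] ge_1[of r] r by (intro divide_left_mono) auto
  then have "exp (- (2 * real n / \<rho> r)) \<le> exp (- (2 * real n / \<rho> (exp M)))" by simp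
  then show ?thesis
    using Phi_tilde_le[of n r] 1 by linarith
qed

text \<open>The radius is rounded up, so the weight does not decrease. The estimate
  \<open>1 + n * r \<le> 2 * (1 + n) * exp M\<close> accounts for \<open>2 powr D\<close> and for
  the logarithm of \<open>1 + n\<close>.\<close>

lemma Phi_tilde_ge_exp:
  assumes b: "b > 0" "\<And>r. volume G S r \<le> b * (1 + real r) powr D" and D: "D > 0"
    and M: "M \<ge> 0" "8 \<le> \<rho> (exp M)"
  shows "exp (- (16 * real n / \<rho> (exp M) + D * ln (1 + real n) + D * M)) / (b * 2 powr D) \<le> Phi_tilde G S \<rho> n"
proof -
  define r where "r = nat \<lceil>exp M\<rceil>"
  have r: "exp M \<le> real r" "real r \<le> 1 + exp M"
    using exp_gt_zero[of M] unfolding r_def by linarith+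
  have \<rho>: "8 \<le> \<rho> r" "\<rho> (exp M) \<le> \<rho> r" using mono_le[of "exp M" r] r M by auto
  have e1: "1 \<le> exp M" using M by simp
  have "real n * real r \<le> real n * (2 * exp M)" using r e1 by (intro mult_left_mono) linarith+
  then have "1 + real (n * r) \<le> 2 * exp M + real n * (2 * exp M)"
    using e1 unfolding of_nat_mult by linarith
  then have "1 + real (n * r) \<le> 2 * ((1 + real n) * exp M)"
    by (simp add: algebra_simps)
  then have "(1 + real (n * r)) powr D \<le> (2 * ((1 + real n) * exp M)) powr D"
    using D by (intro powr_mono2) auto
  also have "\<dots> = 2 powr D * exp (D * ln (1 + real n) + D * M)"
    by (simp add: powr_mult exp_add) (simp add: powr_def)
  finally have "b * (1 + real (n * r)) powr D \<le> b * 2 powr D * exp (D * ln (1 + real n) + D * M)"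
    using b(1) by simp
  with b(2)[of "n * r"] have V: "volume G S (n * r) \<le> b * 2 powr D * exp (D * ln (1 + real n) + D * M)"
    by linarith
  have exp_split: "exp (- (x + y + z)) / c = exp (- x) / (c * exp (y + z))" for x y z c :: real
  proof -
    have "exp (- (x + y + z)) = exp (- x - (y + z))" by (simp add: algebra_simps)
    then show ?thesis by (simp only: exp_diff) simp
  qed
  have "exp (- (16 * real n / \<rho> (exp M) + D * ln (1 + real n) + D * M)) / (b * 2 powr D)
      = exp (- (16 * real n / \<rho> (exp M))) / (b * 2 powr D * exp (D * ln (1 + real n) + D * M))"
    by (rule exp_split)
  also have "\<dots> \<le> exp (- (16 * real n / \<rho> r)) / volume G S (n * r)"
  proof (rule frac_le)
    have "16 * real n / \<rho> r \<le> 16 * real n / \<rho> (exp M)"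
      using \<rho> M by (intro divide_left_mono) auto
    then show "exp (- (16 * real n / \<rho> (exp M))) \<le> exp (- (16 * real n / \<rho> r))" by simp
  qed (use V volume_ge_1[of "n * r"] in auto)
  also have "\<dots> \<le> Phi_tilde G S \<rho> n" by (rule Phi_tilde_ge) (rule \<rho>)
  finally show ?thesis .
qed

text \<open>\<open>exp (M t)\<close> and \<open>exp (N t)\<close> are the radii at which the upper and the lower bound on the
  return probability at time \<open>t\<close> are evaluated.\<close>

lemma simeq_Phi_tilde:
  assumes growth: "polynomial_growth G S D" and D: "D > 0"
    and M: "\<And>t. t \<ge> 1 \<Longrightarrow> F t \<le> D * M t" "\<And>t. t \<ge> 1 \<Longrightarrow> F t * \<rho> (exp (M t)) \<le> c * t"
    and N: "\<And>t. t \<ge> 1 \<Longrightarrow> N t \<ge> 0" "\<And>t. t \<ge> 1 \<Longrightarrow> 8 \<le> \<rho> (exp (N t))"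
      "\<And>t. t \<ge> 1 \<Longrightarrow> D * ln (1 + t) + D * N t \<le> F t / 2 + C"
      "\<And>t. t \<ge> 1 \<Longrightarrow> t \<le> d * (F t * \<rho> (exp (N t)))" "d > 0"
  shows "simeq (step_ext (Phi_tilde G S \<rho>)) (\<lambda>t. exp (- F t))"
proof -
  obtain a b where a: "a > 0" "\<And>r. a * (1 + real r) powr D \<le> volume G S r"
    and b: "b > 0" "\<And>r. volume G S r \<le> b * (1 + real r) powr D"
    using polynomial_growth_bounds[OF growth D] by metis
  \<comment> \<open>\<open>c1\<close> absorbs the sum of the two upper terms.
    \<open>c2 \<ge> 1\<close> makes the rounded time at least half of \<open>c2 * t\<close>, and
    \<open>c2 \<ge> c\<close> then matches the condition on \<open>M\<close>.
    \<open>c4 \<le> 1\<close> gives \<open>n \<le> t\<close>, and the factor 32 makes the weight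
    term at most \<open>F t / 2\<close>.\<close>
  define c1 where "c1 = 1 / (1 + 1 / a)"
  define c2 where "c2 = max 1 c"
  define c3 where "c3 = b * 2 powr D * exp C"
  define c4 where "c4 = min 1 (1 / (32 * d))"
  have pos: "c1 > 0" "c2 > 0" "c3 > 0" "c4 > 0"
    using a b N(5) by (auto simp: c1_def c2_def c3_def c4_def add_pos_pos)
  have upper: "c1 * Phi_tilde G S \<rho> (nat \<lfloor>c2 * t\<rfloor>) \<le> exp (- F t)" if t: "t \<ge> 1" for t
  proof -
    define n where "n = nat \<lfloor>c2 * t\<rfloor>"
    have "1 * 1 \<le> c2 * t" using t by (intro mult_mono) (auto simp: c2_def)
    then have "1 \<le> \<lfloor>c2 * t\<rfloor>" by simp
    then have "real n = of_int \<lfloor>c2 * t\<rfloor>" "1 \<le> real n" unfolding n_def by simp_all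
    then have "c2 * t \<le> 2 * real n" by linarith
    moreover have "c * t \<le> c2 * t" using t by (intro mult_right_mono) (auto simp: c2_def)
    ultimately have "F t * \<rho> (exp (M t)) \<le> 2 * real n" using M(2)[OF t] by linarith
    then have "F t \<le> 2 * real n / \<rho> (exp (M t))"
      using ge_1[of "exp (M t)"] by (simp add: field_simps)
    then have "exp (- (2 * real n / \<rho> (exp (M t)))) \<le> exp (- F t)" by simp
    moreover have "exp (- (D * M t)) / a \<le> exp (- F t) / a"
      using M(1)[OF t] a(1) by (intro divide_right_mono) auto
    ultimately have "Phi_tilde G S \<rho> n \<le> exp (- F t) + exp (- F t) / a"
      using Phi_tilde_le_exp[OF a D, of n "M t"] by linarith
    also have "\<dots> = exp (- F t) * (1 + 1 / a)" by (simp add: algebra_simps)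
    finally have "Phi_tilde G S \<rho> n \<le> exp (- F t) * (1 + 1 / a)" .
    then show ?thesis
      using a(1) add_pos_pos[of 1 "1 / a"] unfolding c1_def n_def by (simp add: field_simps)
  qed
  have lower: "exp (- F t) \<le> c3 * Phi_tilde G S \<rho> (nat \<lfloor>c4 * t\<rfloor>)" if t: "t \<ge> 1" for t
  proof -
    define n where "n = nat \<lfloor>c4 * t\<rfloor>"
    define R where "R = \<rho> (exp (N t))"
    have R: "R \<ge> 8" unfolding R_def by (rule N(2)[OF t])
    have n: "real n \<le> c4 * t" using pos t by (simp add: n_def)
    have "c4 * t \<le> 1 * t" using t by (intro mult_right_mono) (auto simp: c4_def)
    with n have "ln (1 + real n) \<le> ln (1 + t)" by (subst ln_le_cancel_iff) auto
    then have ln: "D * ln (1 + real n) \<le> D * ln (1 + t)" using D by simp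
    have "c4 * t \<le> 1 / (32 * d) * t" using t by (intro mult_right_mono) (auto simp: c4_def)
    also have "\<dots> \<le> F t * R / 32"
      using N(4)[OF t] N(5) by (simp add: R_def field_simps)
    finally have "16 * real n / R \<le> F t / 2"
      using n R by (simp add: field_simps)
    \<comment> \<open>Half of \<open>F t\<close> pays for the mass lost outside the ball, the other
      half, up to \<open>C\<close>, for the volume.\<close>
    then have "16 * real n / R + D * ln (1 + real n) + D * N t \<le> F t + C"
      using ln N(3)[OF t] by linarith
    then have "exp (- F t) \<le> exp C * exp (- (16 * real n / R + D * ln (1 + real n) + D * N t))"
      by (simp flip: exp_add)
    also have "\<dots> \<le> exp C * (b * 2 powr D * Phi_tilde G S \<rho> n)"
      using Phi_tilde_ge_exp[OF b D N(1,2)[OF t], of n] b(1)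
      by (intro mult_left_mono) (auto simp: R_def field_simps)
    finally show ?thesis by (simp add: c3_def n_def mult_ac)
  qed
  show ?thesis
    unfolding simeq_def step_ext_def using pos upper lower by blast
qed

end

section \<open>Iterated logarithms and elementary asymptotics\<close>

lemma iter_log_zero [simp]: "iter_log k 0 = 0"
  by (induction k) auto

lemma iter_log_mono: "0 \<le> x \<Longrightarrow> x \<le> y \<Longrightarrow> 0 \<le> iter_log k x \<and> iter_log k x \<le> iter_log k y"
  by (induction k) auto

lemma iter_log_nonneg: "0 \<le> x \<Longrightarrow> 0 \<le> iter_log k x"
  using iter_log_mono by blast

lemma iter_log_pos: "0 < x \<Longrightarrow> 0 < iter_log k x"
  by (induction k) auto

text \<open>Peels off the innermost logarithm, which at a radius \<open>exp M\<close> is essentially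
  \<open>M\<close>.\<close>

lemma iter_log_Suc': "iter_log (Suc k) x = iter_log k (ln (1 + x))"
  by (induction k) auto

lemma iter_log_Suc_le: "0 \<le> x \<Longrightarrow> iter_log (Suc k) x \<le> ln (1 + x)"
proof (induction k)
  case (Suc k)
  have "iter_log (Suc (Suc k)) x \<le> iter_log (Suc k) x"
    using iter_log_nonneg[OF Suc.prems, of "Suc k"] ln_add_one_self_le_self
    by (simp only: iter_log.simps(2)[of "Suc k"])
  with Suc show ?case by simp
qed simp

text \<open>Bernoulli's inequality \<open>1 + n * x \<le> (1 + x) ^ n\<close>, hence the integer
  factor.\<close>

lemma ln_mult_le:
  assumes "0 \<le> x" "n \<ge> 1"
  shows "ln (1 + real n * x) \<le> real n * ln (1 + x)"
proof -
  have "ln (1 + real n * x) \<le> ln ((1 + x) ^ n)"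
    using Bernoulli_inequality[of x n] assms by (intro ln_mono) (auto simp: add_pos_nonneg)
  then show ?thesis using assms by (simp add: ln_realpow)
qed

lemma iter_log_mult_le:
  assumes "0 \<le> x" "n \<ge> 1"
  shows "iter_log k (real n * x) \<le> real n * iter_log k x"
proof (induction k)
  case (Suc k)
  have "iter_log (Suc k) (real n * x) \<le> ln (1 + real n * iter_log k x)"
    using Suc iter_log_nonneg[of "real n * x" k] assms by simp
  also have "\<dots> \<le> real n * iter_log (Suc k) x"
    using ln_mult_le[OF iter_log_nonneg] assms by simp
  finally show ?case .
qed simp

text \<open>The first logarithm halves under a square root, as
  \<open>1 + x \<le> (1 + sqrt x)\<^sup>2\<close>; each further one preserves the factor by
  \<open>ln (1 + 2 * u) \<le> 2 * ln (1 + u)\<close>.\<close>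

lemma iter_log_sqrt_ge:
  assumes "0 \<le> x"
  shows "iter_log (Suc k) x / 2 \<le> iter_log (Suc k) (sqrt x)"
proof (induction k)
  case 0
  have "ln (1 + x) \<le> ln ((1 + sqrt x)\<^sup>2)"
    using assms by (intro ln_mono) (auto simp: power2_sum add_pos_nonneg)
  then show ?case using assms by (simp add: ln_realpow)
next
  case (Suc k)
  have "iter_log (Suc (Suc k)) x \<le> ln (1 + 2 * iter_log (Suc k) (sqrt x))"
    using Suc iter_log_nonneg[OF assms, of "Suc k"]
    by (simp only: iter_log.simps(2)[of "Suc k"]) simp
  also have "\<dots> \<le> 2 * ln (1 + iter_log (Suc k) (sqrt x))"
    using ln_mult_le[of "iter_log (Suc k) (sqrt x)" 2] assms iter_log_nonneg by simp
  finally show ?case by simp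
qed

lemma filterlim_iter_log: "filterlim (iter_log k) at_top at_top"
proof (induction k)
  case 0
  then show ?case by (simp add: filterlim_ident)
next
  case (Suc k)
  have "filterlim (\<lambda>x::real. ln (1 + x)) at_top at_top" by real_asymp
  from filterlim_compose[OF this Suc] show ?case by simp
qed

lemma weight_function_iter_log:
  "\<epsilon> > 0 \<Longrightarrow> weight_function (\<lambda>s. (1 + iter_log k s) powr \<epsilon>)"
  by unfold_locales
    (auto simp: mono_on_def iter_log_mono iter_log_nonneg add_pos_nonneg intro!: powr_mono2 add_nonneg_nonneg)

text \<open>The weight is unbounded; \<open>K\<close> later shifts logarithmic radii so that the
  weight is at least 8 from \<open>t = 1\<close> on.\<close>

lemma ex_iter_log_weight_ge:
  assumes "\<epsilon> > 0"
  obtains K where "K \<ge> 0" "B \<le> (1 + iter_log k (exp K)) powr \<epsilon>"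
proof -
  have "filterlim (\<lambda>x. (1 + x) powr \<epsilon>) at_top at_top" using assms by real_asymp
  from filterlim_compose[OF this filterlim_iter_log, of k]
  have "eventually (\<lambda>x. B \<le> (1 + iter_log k x) powr \<epsilon>) at_top"
    by (simp add: filterlim_at_top)
  then obtain x where x: "\<And>y. y \<ge> x \<Longrightarrow> B \<le> (1 + iter_log k y) powr \<epsilon>"
    by (auto simp: eventually_at_top_linorder)
  show ?thesis
    using that[of "max 0 (ln (max 1 x))"] x[of "max 1 x"] by simp
qed

lemma ln_le_powr_plus_const:
  assumes "\<alpha> > 0" "\<delta> > 0"
  obtains C where "\<And>t::real. t \<ge> 1 \<Longrightarrow> ln (1 + t) \<le> \<delta> * t powr \<alpha> + C"
proof -
  have "eventually (\<lambda>t::real. ln (1 + t) \<le> \<delta> * t powr \<alpha>) at_top"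
    using assms by real_asymp
  then obtain T where T: "\<And>t::real. t \<ge> T \<Longrightarrow> ln (1 + t) \<le> \<delta> * t powr \<alpha>"
    by (auto simp: eventually_at_top_linorder)
  show ?thesis
  proof (rule that)
    fix t :: real assume t: "t \<ge> 1"
    show "ln (1 + t) \<le> \<delta> * t powr \<alpha> + ln (1 + max 1 T)"
    proof (cases "t \<ge> T")
      case True
      then show ?thesis using T[of t] by (smt (verit) ln_ge_zero)
    next
      case False
      then have "ln (1 + t) \<le> ln (1 + max 1 T)" using t by simp
      then show ?thesis using assms by (smt (verit) mult_nonneg_nonneg powr_ge_zero)
    qed
  qed
qed

text \<open>Asymptotically true without \<open>C\<close>; on the remaining bounded range the left
  side is bounded by its value at the right end.\<close>

lemma ln_sqrt_le_plus_const:
  assumes "D > 0" "\<epsilon> > 0"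
  obtains C where "\<And>t::real. t \<ge> 1 \<Longrightarrow> D * ln (1 + t) + D * sqrt t \<le> t / ln (1 + t) powr \<epsilon> / 2 + C"
proof -
  have "eventually (\<lambda>t::real. D * ln (1 + t) + D * sqrt t \<le> t / ln (1 + t) powr \<epsilon> / 2) at_top"
    using assms by real_asymp
  then obtain T where T: "\<And>t::real. t \<ge> T \<Longrightarrow> D * ln (1 + t) + D * sqrt t \<le> t / ln (1 + t) powr \<epsilon> / 2"
    by (auto simp: eventually_at_top_linorder)
  define C where "C = D * ln (1 + max 1 T) + D * sqrt (max 1 T)"
  have C: "0 \<le> C" using assms by (auto simp: C_def)
  show ?thesis
  proof (rule that)
    fix t :: real assume t: "t \<ge> 1"
    show "D * ln (1 + t) + D * sqrt t \<le> t / ln (1 + t) powr \<epsilon> / 2 + C"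
    proof (cases "t \<ge> T")
      case True
      then show ?thesis using T[of t] C by linarith
    next
      case False
      then have "D * ln (1 + t) + D * sqrt t \<le> C"
        unfolding C_def using t assms by (intro add_mono mult_left_mono) auto
      moreover have "0 \<le> t / ln (1 + t) powr \<epsilon> / 2" using t by simp
      ultimately show ?thesis by linarith
    qed
  qed
qed

text \<open>The upper bound uses \<open>1 + exp M \<le> 2 * exp M \<le> exp (1 + M)\<close>.\<close>

lemma ln_one_plus_exp_bounds:
  assumes "M \<ge> (0::real)"
  shows "M \<le> ln (1 + exp M)" "ln (1 + exp M) \<le> 1 + M"
proof -
  have "exp M \<ge> 1" "2 \<le> exp (1::real)"
    using assms exp_ge_add_one_self[of 1] by auto
  then have "1 + exp M \<le> exp 1 * exp M"
    using mult_right_mono[of 2 "exp (1::real)" "exp M"] by linarith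
  then have "ln (1 + exp M) \<le> ln (exp (1 + M))"
    by (intro ln_mono) (auto simp: exp_add add_pos_pos)
  then show "ln (1 + exp M) \<le> 1 + M" by simp
  have "ln (exp M) \<le> ln (1 + exp M)" by (intro ln_mono) auto
  then show "M \<le> ln (1 + exp M)" by simp
qed

section \<open>Choice of radii for the two families of weights\<close>

context generated_group
begin

text \<open>With logarithmic radius of order \<open>t powr \<alpha>\<close>, the logarithm of the
  volume has order \<open>t powr \<alpha>\<close> and the weight term order
  \<open>t powr (1 - \<alpha> * \<epsilon>)\<close>. They balance for
  \<open>\<alpha> + \<alpha> * \<epsilon> = 1\<close>.\<close>

lemma simeq_Phi_tilde_log:
  assumes growth: "polynomial_growth G S D" and D: "D > 0" and \<epsilon>: "\<epsilon> > 0"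
  shows "simeq (step_ext (Phi_tilde G S (\<lambda>s. (1 + ln (1 + s)) powr \<epsilon>)))
    (\<lambda>t. exp (- (t powr (1 / (1 + \<epsilon>)))))"
proof -
  define \<alpha> where "\<alpha> = 1 / (1 + \<epsilon>)"
  have \<alpha>: "\<alpha> > 0" "\<alpha> + \<alpha> * \<epsilon> = 1" using \<epsilon> by (auto simp: \<alpha>_def field_simps)
  \<comment> \<open>A quarter of \<open>t powr \<alpha>\<close> each goes to
    \<open>D * ln (1 + t)\<close> and to the growing part of \<open>D * N t\<close>, together the
    admissible half.\<close>
  define \<beta> where "\<beta> = 1 / (4 * D)"
  have \<beta>: "\<beta> > 0" using D by (simp add: \<beta>_def)
  interpret weighted_group G S "\<lambda>s. (1 + ln (1 + s)) powr \<epsilon>"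
    using weight_function_iter_log[OF \<epsilon>, of 1] generated_group_axioms
    by (simp add: weighted_group_def)
  obtain K where K: "K \<ge> 0" "8 \<le> (1 + ln (1 + exp K)) powr \<epsilon>"
    using ex_iter_log_weight_ge[OF \<epsilon>, of 8 1] by auto
  obtain C where C: "\<And>t::real. t \<ge> 1 \<Longrightarrow> ln (1 + t) \<le> \<beta> * t powr \<alpha> + C"
    using ln_le_powr_plus_const[OF \<alpha>(1) \<beta>] by blast
  have split: "t powr \<alpha> * (t powr \<alpha>) powr \<epsilon> = t" if "t \<ge> 1" for t :: real
    using that \<alpha>(2) by (simp add: powr_powr flip: powr_add)
  have "simeq (step_ext (Phi_tilde G S (\<lambda>s. (1 + ln (1 + s)) powr \<epsilon>))) (\<lambda>t. exp (- (t powr \<alpha>)))"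
  proof (rule simeq_Phi_tilde[OF growth D, where M = "\<lambda>t. t powr \<alpha> / D" and c = "(2 + 1 / D) powr \<epsilon>"
        and N = "\<lambda>t. K + \<beta> * t powr \<alpha>" and C = "D * C + D * K" and d = "1 / \<beta> powr \<epsilon>"])
    fix t :: real assume t: "t \<ge> 1"
    define T where "T = t powr \<alpha>"
    have T: "T \<ge> 1" using t \<alpha> by (simp add: T_def ge_one_powr_ge_zero)
    show "t powr \<alpha> \<le> D * (t powr \<alpha> / D)" using D by simp
    have "1 + ln (1 + exp (T / D)) \<le> (2 + 1 / D) * T"
      using ln_one_plus_exp_bounds(2)[of "T / D"] T D by (simp add: algebra_simps)
    then have "(1 + ln (1 + exp (T / D))) powr \<epsilon> \<le> ((2 + 1 / D) * T) powr \<epsilon>"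
      using \<epsilon> by (intro powr_mono2) (auto simp: add_nonneg_nonneg)
    also have "\<dots> = (2 + 1 / D) powr \<epsilon> * T powr \<epsilon>"
      using T D by (intro powr_mult)
    finally have "T * (1 + ln (1 + exp (T / D))) powr \<epsilon> \<le> T * ((2 + 1 / D) powr \<epsilon> * T powr \<epsilon>)"
      using T by (intro mult_left_mono) auto
    also have "\<dots> = (2 + 1 / D) powr \<epsilon> * t"
      using split[OF t] by (simp add: T_def mult_ac)
    finally show "t powr \<alpha> * (1 + ln (1 + exp (t powr \<alpha> / D))) powr \<epsilon> \<le> (2 + 1 / D) powr \<epsilon> * t"
      by (simp add: T_def)
    show "0 \<le> K + \<beta> * t powr \<alpha>" using K \<beta> by simp
    have "exp K \<le> exp (K + \<beta> * t powr \<alpha>)" using \<beta> by simp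
    then show "8 \<le> (1 + ln (1 + exp (K + \<beta> * t powr \<alpha>))) powr \<epsilon>"
      using mono_le[of "exp K" "exp (K + \<beta> * t powr \<alpha>)"] K(2) by simp
    have "D * ln (1 + t) \<le> D * (\<beta> * t powr \<alpha> + C)"
      using C[OF t] D by simp
    then show "D * ln (1 + t) + D * (K + \<beta> * t powr \<alpha>) \<le> t powr \<alpha> / 2 + (D * C + D * K)"
      using D by (simp add: \<beta>_def field_simps)
    have "\<beta> * T \<le> 1 + ln (1 + exp (K + \<beta> * T))"
      using ln_one_plus_exp_bounds(1)[of "K + \<beta> * T"] K(1) \<beta> T by simp
    then have "(\<beta> * T) powr \<epsilon> \<le> (1 + ln (1 + exp (K + \<beta> * T))) powr \<epsilon>"
      using \<epsilon> \<beta> T by (intro powr_mono2) auto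
    then have "T * (\<beta> powr \<epsilon> * T powr \<epsilon>) \<le> T * (1 + ln (1 + exp (K + \<beta> * T))) powr \<epsilon>"
      using T \<beta> by (simp add: powr_mult)
    then have "\<beta> powr \<epsilon> * t \<le> T * (1 + ln (1 + exp (K + \<beta> * T))) powr \<epsilon>"
      using split[OF t] by (simp add: T_def mult_ac)
    then show "t \<le> 1 / \<beta> powr \<epsilon> * (t powr \<alpha> * (1 + ln (1 + exp (K + \<beta> * t powr \<alpha>))) powr \<epsilon>)"
      using \<beta> by (simp add: T_def field_simps)
  qed (use \<beta> in simp)
  then show ?thesis by (simp add: \<alpha>_def)
qed

text \<open>At least one logarithm remains in \<open>L\<close>, so \<open>L\<close> changes only by
  bounded factors between arguments of order \<open>t\<close> and \<open>sqrt t\<close>. A linear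
  logarithmic radius thus serves above, and one of order \<open>sqrt t\<close>, whose volume cost is
  negligible, below.\<close>

lemma simeq_Phi_tilde_iter_log:
  assumes growth: "polynomial_growth G S D" and D: "D > 0" and \<epsilon>: "\<epsilon> > 0"
  shows "simeq (step_ext (Phi_tilde G S (\<lambda>s. (1 + iter_log (Suc (Suc i)) s) powr \<epsilon>)))
    (\<lambda>t. exp (- (t / (iter_log (Suc i) t) powr \<epsilon>)))"
proof -
  define L where "L = iter_log (Suc i)"
  have L_Suc: "iter_log (Suc (Suc i)) s = L (ln (1 + s))" for s
    unfolding L_def by (rule iter_log_Suc')
  have L_mono: "L x \<le> L y" if "0 \<le> x" "x \<le> y" for x y
    using iter_log_mono[OF that] by (simp add: L_def del: iter_log.simps)
  have L_pos: "0 < L x" if "0 < x" for x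
    using iter_log_pos[OF that] by (simp add: L_def del: iter_log.simps)
  interpret weighted_group G S "\<lambda>s. (1 + L (ln (1 + s))) powr \<epsilon>"
    using weight_function_iter_log[OF \<epsilon>, of "Suc (Suc i)"] generated_group_axioms
    unfolding L_Suc weighted_group_def by simp
  obtain K where K: "K \<ge> 0" "8 \<le> (1 + L (ln (1 + exp K))) powr \<epsilon>"
    using ex_iter_log_weight_ge[OF \<epsilon>, of 8 "Suc (Suc i)"] unfolding L_Suc by blast
  obtain C where C: "\<And>t::real. t \<ge> 1 \<Longrightarrow> D * ln (1 + t) + D * sqrt t \<le> t / ln (1 + t) powr \<epsilon> / 2 + C"
    using ln_sqrt_le_plus_const[OF D \<epsilon>] by blast
  \<comment> \<open>Since \<open>L t \<ge> L 1\<close>, the target exponent is at most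
    \<open>D * (B * t)\<close>.\<close>
  define B where "B = 1 / (D * L 1 powr \<epsilon>)"
  have L1: "L 1 > 0" by (simp add: L_pos)
  have B: "B > 0" using D L1 by (simp add: B_def)
  \<comment> \<open>An integer above \<open>1 + B\<close>, since \<open>iter_log_mult_le\<close>
    scales by integers and \<open>ln (1 + exp (B * t)) \<le> 1 + B * t\<close>.\<close>
  define n where "n = nat \<lceil>1 + B\<rceil>"
  have n: "1 + B \<le> real n" "n \<ge> 1" using B unfolding n_def by linarith+
  have "simeq (step_ext (Phi_tilde G S (\<lambda>s. (1 + L (ln (1 + s))) powr \<epsilon>))) (\<lambda>t. exp (- (t / L t powr \<epsilon>)))"
  proof (rule simeq_Phi_tilde[OF growth D, where M = "\<lambda>t. B * t" and c = "(real n + 1 / L 1) powr \<epsilon>"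
        and N = "\<lambda>t. K + sqrt t" and C = "C + D * K" and d = "2 powr \<epsilon>"])
    fix t :: real assume t: "t \<ge> 1"
    have Lt: "L 1 \<le> L t" "0 < L t" using L_mono[of 1 t] L_pos[of t] t by auto
    have "L 1 powr \<epsilon> \<le> L t powr \<epsilon>" using Lt L1 \<epsilon> by (intro powr_mono2) auto
    then have "t / L t powr \<epsilon> \<le> t / L 1 powr \<epsilon>"
      using L1 Lt t by (intro divide_left_mono) auto
    then show "t / L t powr \<epsilon> \<le> D * (B * t)"
      using D by (simp add: B_def)
    have "B * t \<ge> 0" using B t by simp
    then have "0 \<le> ln (1 + exp (B * t))" "ln (1 + exp (B * t)) \<le> real n * t"
    proof -
      have "ln (1 + exp (B * t)) \<le> 1 + B * t"
        using \<open>B * t \<ge> 0\<close> by (rule ln_one_plus_exp_bounds)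
      also have "\<dots> \<le> (1 + B) * t" using t by (simp add: algebra_simps)
      also have "\<dots> \<le> real n * t" using n t by (intro mult_right_mono) auto
      finally show "ln (1 + exp (B * t)) \<le> real n * t" .
    qed simp
    then have "L (ln (1 + exp (B * t))) \<le> L (real n * t)" by (rule L_mono)
    also have "\<dots> \<le> real n * L t"
      unfolding L_def using t n by (intro iter_log_mult_le) auto
    finally have "L (ln (1 + exp (B * t))) \<le> real n * L t" .
    \<comment> \<open>Absorbs the additive 1 of the weight into a multiple of
      \<open>L t\<close>.\<close>
    moreover have "1 \<le> 1 / L 1 * L t"
      using Lt L1 by simp
    ultimately have "1 + L (ln (1 + exp (B * t))) \<le> (real n + 1 / L 1) * L t"
      unfolding distrib_right by linarith
    then have "(1 + L (ln (1 + exp (B * t)))) powr \<epsilon> \<le> ((real n + 1 / L 1) * L t) powr \<epsilon>"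
      using \<epsilon> L_pos[OF ln_gt_zero[of "1 + exp (B * t)"]] by (intro powr_mono2) auto
    also have "\<dots> = (real n + 1 / L 1) powr \<epsilon> * L t powr \<epsilon>"
      using Lt L1 by (intro powr_mult)
    finally show "t / L t powr \<epsilon> * (1 + L (ln (1 + exp (B * t)))) powr \<epsilon> \<le> (real n + 1 / L 1) powr \<epsilon> * t"
      using Lt t by (simp add: field_simps)
    show "0 \<le> K + sqrt t" using K t by simp
    have "exp K \<le> exp (K + sqrt t)" using t by simp
    then show "8 \<le> (1 + L (ln (1 + exp (K + sqrt t)))) powr \<epsilon>"
      using mono_le[of "exp K" "exp (K + sqrt t)"] K(2) by simp
    have "L t powr \<epsilon> \<le> ln (1 + t) powr \<epsilon>"
      using Lt \<epsilon> t iter_log_Suc_le[of t i] unfolding L_def by (intro powr_mono2) auto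
    then have "t / ln (1 + t) powr \<epsilon> \<le> t / L t powr \<epsilon>"
      using Lt t by (intro divide_left_mono) auto
    then show "D * ln (1 + t) + D * (K + sqrt t) \<le> t / L t powr \<epsilon> / 2 + (C + D * K)"
      using C[OF t] by (simp add: distrib_left)
    \<comment> \<open>The square root costs a factor 2 in \<open>L\<close>, hence
      \<open>d = 2 powr \<epsilon>\<close>.\<close>
    have "L t / 2 \<le> L (sqrt t)"
      unfolding L_def using t by (intro iter_log_sqrt_ge) simp
    also have "\<dots> \<le> L (ln (1 + exp (K + sqrt t)))"
      using ln_one_plus_exp_bounds(1)[of "K + sqrt t"] K(1) t by (intro L_mono) auto
    finally have "(L t / 2) powr \<epsilon> \<le> (1 + L (ln (1 + exp (K + sqrt t)))) powr \<epsilon>"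
      using \<epsilon> Lt by (intro powr_mono2) auto
    then show "t \<le> 2 powr \<epsilon> * (t / L t powr \<epsilon> * (1 + L (ln (1 + exp (K + sqrt t)))) powr \<epsilon>)"
      using Lt t by (simp add: powr_divide field_simps)
  qed simp
  then show ?thesis unfolding L_Suc by (simp add: L_def del: iter_log.simps)
qed

end

theorem theorem1p7:
  fixes G :: "('a, 'b) monoid_scheme" and S :: "'a list" and D :: real
  assumes "group G"
    and "generating_tuple G S"
    and "polynomial_growth G S D"
    and "D > 0"
  shows "(\<forall>\<epsilon>::real. \<epsilon> > 0 \<longrightarrow>
            simeq (step_ext (Phi_tilde G S (\<lambda>s. (1 + ln (1 + s)) powr \<epsilon>)))
                  (\<lambda>t. exp (- (t powr (1 / (1 + \<epsilon>))))))
       \<and> (\<forall>(\<epsilon>::real) (k::nat). \<epsilon> > 0 \<longrightarrow> k \<ge> 2 \<longrightarrow>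
            simeq (step_ext (Phi_tilde G S (\<lambda>s. (1 + iter_log k s) powr \<epsilon>)))
                  (\<lambda>t. exp (- (t / (iter_log (k - 1) t) powr \<epsilon>))))"
proof (intro conjI allI impI)
  interpret generated_group G S
    using assms(1,2) by (simp add: generated_group_def generated_group_axioms_def)
  show "simeq (step_ext (Phi_tilde G S (\<lambda>s. (1 + ln (1 + s)) powr \<epsilon>)))
      (\<lambda>t. exp (- (t powr (1 / (1 + \<epsilon>)))))" if "\<epsilon> > 0" for \<epsilon> :: real
    using assms(3,4) that by (rule simeq_Phi_tilde_log)
  show "simeq (step_ext (Phi_tilde G S (\<lambda>s. (1 + iter_log k s) powr \<epsilon>)))
      (\<lambda>t. exp (- (t / (iter_log (k - 1) t) powr \<epsilon>)))" if "\<epsilon> > 0" "k \<ge> 2" for \<epsilon> :: real and k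
  proof -
    obtain i where "k = Suc (Suc i)" using \<open>k \<ge> 2\<close> by (metis add_2_eq_Suc le_Suc_ex)
    then show ?thesis
      using simeq_Phi_tilde_iter_log[OF assms(3,4) \<open>\<epsilon> > 0\<close>, of i] by (simp del: iter_log.simps)
  qed
qed

end
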